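(* Let $p\in\mathbb{N}$, $p>1$, and let $\mathbf{M}=(M_1,\dots,M_p)$ be a mean-type mapping such that the means $M_1,\dots,M_p\colon(0,\infty)^p\to(0,\infty)$ are strictly monotone and homogeneous. Then: (i) there is a unique $\mathbf{M}$-invariant mean $K\colon(0,\infty)^p\to(0,\infty)$, and the sequence $(\mathbf{M}^n)_{n\in\mathbb{N}}$ of iterates of $\mathbf{M}$ converges, uniformly on compact subsets of $(0,\infty)^p$, to the mean-type mapping $\mathbf{K}=(K,\dots,K)$; (ii) $K$ is monotone and homogeneous, and for every nonempty $S\subseteq\{1,\dots,p\}$ the sequence of iterates of $\mathbf{K}_S(\mathbf{M})$ converges, uniformly on compact subsets of $(0,\infty)^p$, to the mean-type mapping $\mathbf{K}=(K,\dots,K)$; (iii) a function $F\colon(0,\infty)^p\to\mathbb{R}$ is continuous on the diagonal $\Delta((0,\infty)^p)$ and satisfies the functional equation $$F\circ\mathbf{M}=F$$ if and only if $F=\varphi\circ K$ for some continuous function $\varphi\colon(0,\infty)\to\mathbb{R}$ of a single variable; (iv) a function $F\colon(0,\infty)^p\to\mathbb{R}$ is continuous on the diagonal $\Delta((0,\infty)^p)$ and satisfies the simultaneous system of functional equations $$F\circ\mathbf{K}_S(\mathbf{M})=F\quad\text{for all nonempty } S\subseteq\{1,\dots,p\}$$ if and only if $F=\varphi\circ K$ for some continuous function $\varphi\colon(0,\infty)\to\mathbb{R}$ of a single variable (so, for functions $F$ continuous on the diagonal, the equation in (iii) and the system in (iv) are equivalent).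
   Context: A function $M\colon I^p\to I$ ($I$ an interval) is a mean if $\min(x_1,\dots,x_p)\le M(x_1,\dots,x_p)\le\max(x_1,\dots,x_p)$ for all $x_1,\dots,x_p\in I$. A mean is monotone (equivalently here: strictly monotone) if it is strictly increasing in each of its variables. A mean $M$ on $(0,\infty)^p$ is homogeneous if $M(tx)=tM(x)$ for all $t>0$ and $x\in(0,\infty)^p$. A mapping $\mathbf{M}\colon I^p\to I^p$ is mean-type if each of its coordinates is a mean. $K$ is $\mathbf{M}$-invariant if $K\circ\mathbf{M}=K$. $\mathbf{M}^n$ denotes the $n$-fold composition of $\mathbf{M}$ with itself. The diagonal is $\Delta((0,\infty)^p):=\{(x_1,\dots,x_p)\in(0,\infty)^p\colon x_1=\dots=x_p\}$, and $F$ is continuous on the diagonal if $F$ is continuous (as a function on $(0,\infty)^p$) at every point of the diagonal. Complementary averaging: if $K\colon I^p\to I$ is a continuous and monotone mean with $K\circ\mathbf{M}=K$ for a mean-type mapping $\mathbf{M}=(M_1,\dots,M_p)$, then for every nonempty $S\subseteq\{1,\dots,p\}$ there is a unique mean $K_S(\mathbf{M})\colon I^p\to I$ such that $K\circ\mathbf{K}_S(\mathbf{M})=K$, where $\mathbf{K}_S(\mathbf{M})\colon I^p\to I^p$ has $i$-th coordinate $K_S(\mathbf{M})$ for $i\in S$ and $M_i$ for $i\notin S$. This defines $K_S(\mathbf{M})$ and $\mathbf{K}_S(\mathbf{M})$; here $I=(0,\infty)$ and $K$ is the mean from (i). *)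

theory Defs
  imports "HOL-Analysis.Analysis"
begin

definition cpow :: "real set \<Rightarrow> (real ^ 'n) set"
  where "cpow I = {x. \<forall>i. x $ i \<in> I}"

definition diagonal :: "real set \<Rightarrow> (real ^ 'n) set"
  where "diagonal I = {x \<in> cpow I. \<forall>i j. x $ i = x $ j}"

text \<open>Functions with domain \<open>cpow I\<close> are total functions whose values outside \<open>cpow I\<close>
  are irrelevant; equations between them are required on \<open>cpow I\<close> only.\<close>

definition is_mean :: "real set \<Rightarrow> (real ^ 'n \<Rightarrow> real) \<Rightarrow> bool"
  where "is_mean I M \<longleftrightarrow> M \<in> cpow I \<rightarrow> I \<and>
    (\<forall>x\<in>cpow I. Min (range (\<lambda>i. x $ i)) \<le> M x \<and> M x \<le> Max (range (\<lambda>i. x $ i)))"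

definition monotone_mean :: "real set \<Rightarrow> (real ^ 'n \<Rightarrow> real) \<Rightarrow> bool"
  where "monotone_mean I M \<longleftrightarrow> is_mean I M \<and>
    (\<forall>x\<in>cpow I. \<forall>i. strict_mono_on I (\<lambda>t. M (\<chi> j. if j = i then t else x $ j)))"

definition homogeneous :: "(real ^ 'n \<Rightarrow> real) \<Rightarrow> bool"
  where "homogeneous M \<longleftrightarrow> (\<forall>t>0. \<forall>x\<in>cpow {0<..}. M (t *\<^sub>R x) = t * M x)"

definition mean_type :: "real set \<Rightarrow> (real ^ 'n \<Rightarrow> real ^ 'n) \<Rightarrow> bool"
  where "mean_type I M \<longleftrightarrow> (\<forall>i. is_mean I (\<lambda>x. M x $ i))"

definition invariant :: "real set \<Rightarrow> (real ^ 'n \<Rightarrow> real ^ 'n) \<Rightarrow> (real ^ 'n \<Rightarrow> real) \<Rightarrow> bool"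
  where "invariant I M K \<longleftrightarrow> (\<forall>x\<in>cpow I. K (M x) = K x)"

definition subst_coords ::
    "'n set \<Rightarrow> (real ^ 'n \<Rightarrow> real) \<Rightarrow> (real ^ 'n \<Rightarrow> real ^ 'n) \<Rightarrow> real ^ 'n \<Rightarrow> real ^ 'n"
  where "subst_coords S N M = (\<lambda>x. \<chi> i. if i \<in> S then N x else M x $ i)"

text \<open>The mean \<open>K\<^sub>S(M)\<close>. Membership in \<open>extensional\<close> fixes the values outside \<open>cpow I\<close>, so that
  uniqueness on \<open>cpow I\<close> is uniqueness as a HOL function; see \<open>ex1_compl_mean\<close> below.\<close>

definition compl_mean :: "real set \<Rightarrow> (real ^ 'n \<Rightarrow> real) \<Rightarrow> (real ^ 'n \<Rightarrow> real ^ 'n) \<Rightarrow>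
    'n set \<Rightarrow> real ^ 'n \<Rightarrow> real"
  where "compl_mean I K M S =
    (THE N. N \<in> extensional (cpow I) \<and> is_mean I N \<and> invariant I (subst_coords S N M) K)"

definition compl_map :: "real set \<Rightarrow> (real ^ 'n \<Rightarrow> real) \<Rightarrow> (real ^ 'n \<Rightarrow> real ^ 'n) \<Rightarrow>
    'n set \<Rightarrow> real ^ 'n \<Rightarrow> real ^ 'n"
  where "compl_map I K M S = subst_coords S (compl_mean I K M S) M"

definition iterates_converge ::
    "real set \<Rightarrow> (real ^ 'n \<Rightarrow> real ^ 'n) \<Rightarrow> (real ^ 'n \<Rightarrow> real ^ 'n) \<Rightarrow> bool"
  where "iterates_converge I M L \<longleftrightarrow>
    (\<forall>C. compact C \<and> C \<subseteq> cpow I \<longrightarrow> uniform_limit C (\<lambda>n. M ^^ n) L sequentially)"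

definition continuous_on_diagonal :: "real set \<Rightarrow> (real ^ 'n \<Rightarrow> real) \<Rightarrow> bool"
  where "continuous_on_diagonal I F \<longleftrightarrow> (\<forall>x\<in>diagonal I. continuous (at x within cpow I) F)"

lemma monotone_mean_le:
  fixes x y :: "real ^ 'n"
  assumes K: "monotone_mean I K" and x: "x \<in> cpow I" and y: "y \<in> cpow I"
    and le: "\<And>i. x $ i \<le> y $ i"
  shows "K x \<le> K y"
proof -
  define z where "z A = (\<chi> i. if i \<in> A then y $ i else x $ i)" for A
  have z_in: "z A \<in> cpow I" for A
    using x y by (auto simp: cpow_def z_def)
  have "K x \<le> K (z A)" if "finite A" for A
    using that
  proof (induction A rule: finite_induct)
    case empty
    have "z {} = x" by (simp add: z_def vec_eq_iff)
    then show ?case by simp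
  next
    case (insert a A)
    let ?f = "\<lambda>t. K (\<chi> j. if j = a then t else z A $ j)"
    have "strict_mono_on I ?f"
      using K z_in unfolding monotone_mean_def by blast
    then have "mono_on I ?f"
      by (rule strict_mono_on_imp_mono_on)
    then have "?f (x $ a) \<le> ?f (y $ a)"
      using x y le by (auto intro: mono_onD simp: cpow_def)
    moreover have "(\<chi> j. if j = a then x $ a else z A $ j) = z A"
      using insert.hyps by (auto simp: z_def vec_eq_iff)
    moreover have "(\<chi> j. if j = a then y $ a else z A $ j) = z (insert a A)"
      by (auto simp: z_def vec_eq_iff)
    ultimately show ?case using insert.IH by simp
  qed
  from this[of UNIV] show ?thesis
    by (simp add: z_def vec_nth_inverse)
qed

lemma monotone_mean_less:
  fixes x y :: "real ^ 'n"
  assumes K: "monotone_mean I K" and x: "x \<in> cpow I" and y: "y \<in> cpow I"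
    and le: "\<And>i. x $ i \<le> y $ i" and less: "x $ k < y $ k"
  shows "K x < K y"
proof -
  let ?z = "\<chi> j. if j = k then y $ k else x $ j"
  have "strict_mono_on I (\<lambda>t. K (\<chi> j. if j = k then t else x $ j))"
    using K x unfolding monotone_mean_def by blast
  then have "K (\<chi> j. if j = k then x $ k else x $ j) < K ?z"
    using x y less by (auto simp: cpow_def strict_mono_on_def)
  moreover have "(\<chi> j. if j = k then x $ k else x $ j) = x"
    by (simp add: vec_eq_iff)
  moreover have "K ?z \<le> K y"
    using x y le by (intro monotone_mean_le[OF K]) (auto simp: cpow_def)
  ultimately show ?thesis by simp
qed

lemma ex1_compl_mean:
  fixes K :: "real ^ 'n \<Rightarrow> real" and M :: "real ^ 'n \<Rightarrow> real ^ 'n"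
  assumes I: "is_interval I" and cont: "continuous_on (cpow I) K" and K: "monotone_mean I K"
    and M: "mean_type I M" and inv: "invariant I M K" and S: "S \<noteq> {}"
  shows "\<exists>!N. N \<in> extensional (cpow I) \<and> is_mean I N \<and> invariant I (subst_coords S N M) K"
proof -
  define v where "v x t = (\<chi> i. if i \<in> S then t else M x $ i)" for x t
  have M_in: "M x $ i \<in> I" if "x \<in> cpow I" for x i
    using M that by (auto simp: mean_type_def is_mean_def)
  have v_in: "v x t \<in> cpow I" if "x \<in> cpow I" "t \<in> I" for x t
    using that M_in by (auto simp: cpow_def v_def)
  have uniq: "s = t" if "x \<in> cpow I" "s \<in> I" "t \<in> I" "K (v x s) = K (v x t)" for x s t
  proof -
    obtain k where k: "k \<in> S" using S by blast
    have "\<not> s < t" if "s \<in> I" "t \<in> I" "K (v x s) = K (v x t)" for s t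
    proof
      assume "s < t"
      then have "K (v x s) < K (v x t)"
        using k that \<open>x \<in> cpow I\<close>
        by (intro monotone_mean_less[OF K v_in v_in, where k = k]) (auto simp: v_def)
      then show False using that by simp
    qed
    then show ?thesis using that by (metis linorder_neqE_linordered_idom)
  qed
  have ex: "\<exists>t\<in>I. Min (range (\<lambda>i. x $ i)) \<le> t \<and> t \<le> Max (range (\<lambda>i. x $ i)) \<and> K (v x t) = K x"
    if x: "x \<in> cpow I" for x
  proof -
    let ?a = "Min (range (\<lambda>i. x $ i))" and ?b = "Max (range (\<lambda>i. x $ i))"
    have "?a \<in> range (\<lambda>i. x $ i)" "?b \<in> range (\<lambda>i. x $ i)"
      by (rule Min_in Max_in; simp)+
    then have ab: "?a \<in> I" "?b \<in> I"
      using x unfolding cpow_def by force+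
    have sub: "t \<in> I" if "?a \<le> t" "t \<le> ?b" for t
      using I ab that by (meson is_interval_1)
    have bnd: "?a \<le> M x $ i" "M x $ i \<le> ?b" for i
      using M x by (auto simp: mean_type_def is_mean_def)
    have Mx: "M x \<in> cpow I" using M_in x by (auto simp: cpow_def)
    have KM: "K (M x) = K x" using inv x by (simp add: invariant_def)
    have "K (v x ?a) \<le> K (M x)"
      using bnd x ab by (intro monotone_mean_le[OF K v_in Mx]) (auto simp: v_def)
    moreover have "K (M x) \<le> K (v x ?b)"
      using bnd x ab by (intro monotone_mean_le[OF K Mx v_in]) (auto simp: v_def)
    moreover have "?a \<le> ?b" by (meson bnd order_trans)
    moreover have "continuous_on {?a..?b} (\<lambda>t. K (v x t))"
    proof (rule continuous_on_compose2[OF cont])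
      show "continuous_on {?a..?b} (v x)"
        unfolding v_def
        by (intro continuous_on_vec_lambda, rename_tac i, case_tac "i \<in> S") simp_all
      show "v x ` {?a..?b} \<subseteq> cpow I" using v_in[OF x] sub by auto
    qed
    ultimately obtain t where "?a \<le> t" "t \<le> ?b" "K (v x t) = K x"
      using IVT'[of "\<lambda>t. K (v x t)" ?a "K x" ?b] KM by auto
    then show ?thesis using sub by blast
  qed
  define N where "N = restrict (\<lambda>x. SOME t. t \<in> I \<and> Min (range (\<lambda>i. x $ i)) \<le> t \<and>
    t \<le> Max (range (\<lambda>i. x $ i)) \<and> K (v x t) = K x) (cpow I)"
  have N: "N x \<in> I \<and> Min (range (\<lambda>i. x $ i)) \<le> N x \<and> N x \<le> Max (range (\<lambda>i. x $ i)) \<and>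
      K (v x (N x)) = K x" if x: "x \<in> cpow I" for x
    using someI_ex[OF ex[OF x, unfolded Bex_def]] x unfolding N_def by simp
  have sv: "subst_coords S N' M x = v x (N' x)" for N' x
    by (simp add: subst_coords_def v_def)
  show ?thesis
  proof (rule ex1I[of _ N])
    show "N \<in> extensional (cpow I) \<and> is_mean I N \<and> invariant I (subst_coords S N M) K"
      using N by (auto simp: N_def is_mean_def invariant_def sv)
  next
    fix N' assume N': "N' \<in> extensional (cpow I) \<and> is_mean I N' \<and> invariant I (subst_coords S N' M) K"
    show "N' = N"
    proof (rule extensionalityI[of _ "cpow I"])
      show "N' \<in> extensional (cpow I)" using N' by simp
      show "N \<in> extensional (cpow I)" by (simp add: N_def)
      fix x :: "real ^ 'n" assume x: "x \<in> cpow I"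
      have "K (v x (N' x)) = K (v x (N x))" "N' x \<in> I"
        using N' N[OF x] x by (auto simp: invariant_def sv is_mean_def)
      then show "N' x = N x" using uniq[OF x] N[OF x] by blast
    qed
  qed
qed

end

theory Submission
  imports Defs
begin

text \<open>
  The quantity that drives everything is the spread of a vector, its largest minus its smallest
  coordinate. A mean-type map never increases it. Call the map \<^emph>\<open>averaging\<close> if it is continuous and
  sends every vector with two different coordinates strictly inside the range of its coordinates,
  so that the spread of such a vector drops. Along an orbit the spread then tends to \<open>0\<close>: the orbit
  stays in a compact box, and at a limit point the spread can no longer drop, so the limit point is
  constant (\<open>averaging_spread_tendsto_0\<close>). As the spreads decrease with \<open>n\<close> and are continuous, this
  is uniform on compact sets, by Dini's argument.

  For any mean-type map the smallest coordinate increases along orbits, and its limit is an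
  invariant mean \<open>K\<close> (\<open>ex_invariant_mean\<close>). An invariant mean lies between the smallest and
  largest coordinates of every iterate; hence for an averaging map it is unique, and the iterates
  converge to \<open>(K, ..., K)\<close>. A function \<open>F\<close> that is invariant and continuous on the diagonal
  satisfies \<open>F x = F (T\<^sup>n x) \<longrightarrow> F (K x, ..., K x)\<close>, so it is a continuous function of \<open>K\<close>
  (\<open>averaging_invariant_function_iff\<close>).

  It remains to see that all maps in question are averaging and that their invariant mean is \<open>K\<close>.
  Monotone means lie strictly between the extremes off the diagonal, and monotone homogeneous means
  are automatically continuous; this settles \<open>M\<close>. The mean \<open>K\<close> inherits homogeneity and monotonicity
  from the iterates, hence continuity. The substituted map \<open>K\<^sub>S(M)\<close> leaves \<open>K\<close> invariant by
  construction, and its new coordinate is the unique solution \<open>t\<close> of an equation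
  \<open>K (..., t, ...) = K x\<close> with strictly increasing left-hand side; comparing signs shows that this
  solution is continuous in \<open>x\<close> and strictly between the extremes (\<open>compl_map_averaging\<close>).
\<close>

section \<open>Extreme coordinates and the spread\<close>

definition coord_min :: "real ^ 'n \<Rightarrow> real"
  where "coord_min x = Min (range (\<lambda>i. x $ i))"

definition coord_max :: "real ^ 'n \<Rightarrow> real"
  where "coord_max x = Max (range (\<lambda>i. x $ i))"

definition spread :: "real ^ 'n \<Rightarrow> real"
  where "spread x = coord_max x - coord_min x"

lemma coord_min_le: "coord_min x \<le> x $ i"
  by (simp add: coord_min_def)

lemma le_coord_max: "x $ i \<le> coord_max x"
  by (simp add: coord_max_def)

lemma coord_min_attained: "\<exists>i. coord_min x = x $ i"
proof -
  have "coord_min x \<in> range (\<lambda>i. x $ i)"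
    unfolding coord_min_def by (rule Min_in) auto
  then show ?thesis by auto
qed

lemma coord_max_attained: "\<exists>i. coord_max x = x $ i"
proof -
  have "coord_max x \<in> range (\<lambda>i. x $ i)"
    unfolding coord_max_def by (rule Max_in) auto
  then show ?thesis by auto
qed

lemma coord_min_greatest: "(\<And>i. c \<le> x $ i) \<Longrightarrow> c \<le> coord_min x"
  using coord_min_attained[of x] by auto

lemma coord_max_least: "(\<And>i. x $ i \<le> c) \<Longrightarrow> coord_max x \<le> c"
  using coord_max_attained[of x] by auto

lemma coord_min_in: "x \<in> cpow I \<Longrightarrow> coord_min x \<in> I"
  using coord_min_attained[of x] by (auto simp: cpow_def)

lemma coord_max_in: "x \<in> cpow I \<Longrightarrow> coord_max x \<in> I"
  using coord_max_attained[of x] by (auto simp: cpow_def)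

lemma coord_min_const [simp]: "coord_min (\<chi> i. c) = c"
  by (simp add: coord_min_def)

lemma coord_max_const [simp]: "coord_max (\<chi> i. c) = c"
  by (simp add: coord_max_def)

lemma spread_nonneg: "0 \<le> spread x"
  using coord_min_le[of x] le_coord_max[of x] unfolding spread_def
  by (meson diff_ge_0_iff_ge order_trans)

lemma spread_eq_0D: "spread x = 0 \<Longrightarrow> x $ i = coord_min x"
  using coord_min_le[of x i] le_coord_max[of x i] by (simp add: spread_def)

lemma coord_min_lipschitz: "coord_min x - coord_min y \<le> dist x y"
proof -
  obtain i where i: "coord_min y = y $ i" using coord_min_attained by blast
  show ?thesis
    using coord_min_le[of x i] dist_vec_nth_le[of x i y] i by (simp add: dist_real_def)
qed

lemma coord_max_lipschitz: "coord_max x - coord_max y \<le> dist x y"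
proof -
  obtain i where i: "coord_max x = x $ i" using coord_max_attained by blast
  show ?thesis
    using le_coord_max[of y i] dist_vec_nth_le[of x i y] i by (simp add: dist_real_def)
qed

lemma tendsto_coord_min: "(f \<longlongrightarrow> l) F \<Longrightarrow> ((\<lambda>y. coord_min (f y)) \<longlongrightarrow> coord_min l) F"
proof (rule tendstoI, drule tendstoD, assumption, erule eventually_mono)
  fix e y assume "dist (f y) l < e"
  then show "dist (coord_min (f y)) (coord_min l) < e"
    using coord_min_lipschitz[of "f y" l] coord_min_lipschitz[of l "f y"]
    by (auto simp: dist_real_def dist_commute)
qed

lemma tendsto_coord_max: "(f \<longlongrightarrow> l) F \<Longrightarrow> ((\<lambda>y. coord_max (f y)) \<longlongrightarrow> coord_max l) F"
proof (rule tendstoI, drule tendstoD, assumption, erule eventually_mono)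
  fix e y assume "dist (f y) l < e"
  then show "dist (coord_max (f y)) (coord_max l) < e"
    using coord_max_lipschitz[of "f y" l] coord_max_lipschitz[of l "f y"]
    by (auto simp: dist_real_def dist_commute)
qed

lemma tendsto_spread: "(f \<longlongrightarrow> l) F \<Longrightarrow> ((\<lambda>y. spread (f y)) \<longlongrightarrow> spread l) F"
  unfolding spread_def by (intro tendsto_diff tendsto_coord_min tendsto_coord_max)

lemma continuous_on_spread: "continuous_on A spread"
  unfolding continuous_on_def by (intro ballI tendsto_spread tendsto_ident_at)

section \<open>Orbits of mean-type maps\<close>

lemma is_meanD:
  assumes "is_mean I N" "x \<in> cpow I"
  shows "N x \<in> I" "coord_min x \<le> N x" "N x \<le> coord_max x"
  using assms by (auto simp: is_mean_def coord_min_def coord_max_def)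

lemma is_meanI:
  assumes "\<And>x. x \<in> cpow I \<Longrightarrow> N x \<in> I \<and> coord_min x \<le> N x \<and> N x \<le> coord_max x"
  shows "is_mean I N"
  using assms unfolding is_mean_def coord_min_def coord_max_def by blast

lemma mean_typeD:
  assumes "mean_type I T" "x \<in> cpow I"
  shows "T x \<in> cpow I" "coord_min x \<le> T x $ i" "T x $ i \<le> coord_max x"
    "coord_min x \<le> coord_min (T x)" "coord_max (T x) \<le> coord_max x"
proof -
  have m: "is_mean I (\<lambda>x. T x $ i)" for i
    using assms(1) by (simp add: mean_type_def)
  note d = is_meanD[OF m assms(2)]
  show "T x \<in> cpow I" "coord_min x \<le> T x $ i" "T x $ i \<le> coord_max x"
    using d by (auto simp: cpow_def)
  show "coord_min x \<le> coord_min (T x)" "coord_max (T x) \<le> coord_max x"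
    using d by (auto intro: coord_min_greatest coord_max_least)
qed

lemma invariantD: "invariant I T F \<Longrightarrow> x \<in> cpow I \<Longrightarrow> F (T x) = F x"
  by (simp add: invariant_def)

lemma iterate_in_cpow:
  assumes "mean_type I T" "x \<in> cpow I"
  shows "(T ^^ n) x \<in> cpow I"
  by (induction n) (use assms mean_typeD(1) in auto)

lemma invariant_iterate:
  assumes "mean_type I T" "invariant I T F" "x \<in> cpow I"
  shows "F ((T ^^ n) x) = F x"
  by (induction n) (simp_all add: invariantD[OF assms(2) iterate_in_cpow[OF assms(1,3)]])

lemma incseq_coord_min_iterates:
  assumes "mean_type I T" "x \<in> cpow I"
  shows "incseq (\<lambda>n. coord_min ((T ^^ n) x))"
  using mean_typeD(4)[OF assms(1) iterate_in_cpow[OF assms]] by (intro incseq_SucI) simp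

lemma decseq_coord_max_iterates:
  assumes "mean_type I T" "x \<in> cpow I"
  shows "decseq (\<lambda>n. coord_max ((T ^^ n) x))"
  using mean_typeD(5)[OF assms(1) iterate_in_cpow[OF assms]] by (intro decseq_SucI) simp

lemma decseq_spread_iterates:
  assumes "mean_type I T" "x \<in> cpow I"
  shows "decseq (\<lambda>n. spread ((T ^^ n) x))"
  using incseq_coord_min_iterates[OF assms] decseq_coord_max_iterates[OF assms]
  unfolding spread_def incseq_def decseq_def by (meson diff_mono)

section \<open>Averaging maps contract the spread to zero\<close>

text \<open>Strictness is required of each coordinate, rather than of the spread of the image, because
  replacing some of the coordinates has to preserve the property for the others.\<close>

definition averaging :: "real set \<Rightarrow> (real ^ 'n \<Rightarrow> real ^ 'n) \<Rightarrow> bool"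
  where "averaging I T \<longleftrightarrow> mean_type I T \<and> continuous_on (cpow I) T \<and>
    (\<forall>x\<in>cpow I. spread x \<noteq> 0 \<longrightarrow> (\<forall>i. coord_min x < T x $ i \<and> T x $ i < coord_max x))"

lemma averagingD:
  assumes "averaging I T"
  shows "mean_type I T" "continuous_on (cpow I) T"
    "\<And>x i. x \<in> cpow I \<Longrightarrow> spread x \<noteq> 0 \<Longrightarrow> coord_min x < T x $ i"
    "\<And>x i. x \<in> cpow I \<Longrightarrow> spread x \<noteq> 0 \<Longrightarrow> T x $ i < coord_max x"
  using assms by (auto simp: averaging_def)

lemma averaging_spread_less:
  assumes "averaging I T" "x \<in> cpow I" "spread x \<noteq> 0"
  shows "spread (T x) < spread x"
  using averagingD(3,4)[OF assms] coord_min_attained[of "T x"] coord_max_attained[of "T x"]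
  unfolding spread_def by (metis diff_strict_mono)

text \<open>Decreasing spreads have a limit \<open>s\<close>. By continuity both a limit point \<open>z\<close> of the orbit and its
  image \<open>T z\<close> have spread \<open>s\<close>, which strictness permits only for \<open>s = 0\<close>. Convexity of \<open>I\<close> keeps the
  box spanned by the extreme coordinates of the starting point, and with it \<open>z\<close>, inside the domain.\<close>

lemma averaging_spread_tendsto_0:
  fixes T :: "real ^ 'n \<Rightarrow> real ^ 'n"
  assumes I: "is_interval I" and T: "averaging I T" and x: "x \<in> cpow I"
  shows "(\<lambda>n. spread ((T ^^ n) x)) \<longlonglongrightarrow> 0"
proof -
  note mt = averagingD(1)[OF T]
  let ?y = "\<lambda>n. (T ^^ n) x"
  have y_in: "?y n \<in> cpow I" for n by (rule iterate_in_cpow[OF mt x])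
  define B :: "(real ^ 'n) set" where "B = cbox (\<chi> i. coord_min x) (\<chi> i. coord_max x)"
  have "coord_min x \<le> ?y n $ i" "?y n $ i \<le> coord_max x" for n i
  proof -
    show "coord_min x \<le> ?y n $ i"
      using incseqD[OF incseq_coord_min_iterates[OF mt x], of 0 n] coord_min_le[of "?y n" i] by simp
    show "?y n $ i \<le> coord_max x"
      using decseqD[OF decseq_coord_max_iterates[OF mt x], of 0 n] le_coord_max[of "?y n" i] by simp
  qed
  then have y_B: "?y n \<in> B" for n by (simp add: B_def mem_box_cart)
  have B_sub: "B \<subseteq> cpow I"
  proof
    fix y assume "y \<in> B"
    then have "coord_min x \<le> y $ i" "y $ i \<le> coord_max x" for i
      by (simp_all add: B_def mem_box_cart)
    then show "y \<in> cpow I"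
      using I coord_min_in[OF x] coord_max_in[OF x] unfolding cpow_def is_interval_1 by blast
  qed
  obtain s where s: "(\<lambda>n. spread (?y n)) \<longlonglongrightarrow> s"
    using decseq_convergent[OF decseq_spread_iterates[OF mt x], of 0] spread_nonneg by blast
  have "seq_compact B" by (simp add: B_def compact_imp_seq_compact)
  then obtain z r where z: "z \<in> B" and r: "strict_mono r" and yz: "(?y \<circ> r) \<longlonglongrightarrow> z"
    using y_B by (blast elim: seq_compactE[of B ?y])
  have "((\<lambda>n. spread (?y n)) \<circ> r) \<longlonglongrightarrow> s"
    by (rule LIMSEQ_subseq_LIMSEQ[OF s r])
  moreover have "((\<lambda>n. spread (?y n)) \<circ> r) \<longlonglongrightarrow> spread z"
    using tendsto_spread[OF yz] by (simp add: o_def)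
  ultimately have sz: "spread z = s" by (rule LIMSEQ_unique[rotated])
  have "(\<lambda>n. T ((?y \<circ> r) n)) \<longlonglongrightarrow> T z"
    by (rule continuous_on_tendsto_compose[OF averagingD(2)[OF T] yz])
      (use z B_sub y_in in auto)
  from tendsto_spread[OF this] have "(\<lambda>n. spread (?y (Suc (r n)))) \<longlonglongrightarrow> spread (T z)"
    by simp
  moreover have "((\<lambda>n. spread (?y (Suc n))) \<circ> r) \<longlonglongrightarrow> s"
    by (rule LIMSEQ_subseq_LIMSEQ[OF LIMSEQ_Suc[OF s] r])
  ultimately have "spread (T z) = s"
    by (simp add: o_def LIMSEQ_unique)
  then have "spread z = 0"
    using averaging_spread_less[OF T, of z] z B_sub sz by auto
  then show ?thesis using s sz by simp
qed

text \<open>Dini's theorem for the limit \<open>0\<close>: points \<open>x N\<close> with \<open>f N (x N) \<ge> e\<close> would accumulate at a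
  point \<open>z\<close>, and monotonicity in \<open>n\<close> would force \<open>f m z \<ge> e\<close> for every \<open>m\<close>.\<close>

lemma decreasing_continuous_uniform_limit_0:
  fixes f :: "nat \<Rightarrow> 'a::metric_space \<Rightarrow> real"
  assumes C: "compact C" and cont: "\<And>n. continuous_on C (f n)"
    and dec: "\<And>x. x \<in> C \<Longrightarrow> decseq (\<lambda>n. f n x)"
    and lim: "\<And>x. x \<in> C \<Longrightarrow> (\<lambda>n. f n x) \<longlonglongrightarrow> 0"
  shows "uniform_limit C f (\<lambda>_. 0) sequentially"
proof (rule uniform_limitI)
  fix e :: real assume e: "e > 0"
  have nonneg: "0 \<le> f n x" if "x \<in> C" for n x
    by (rule decseq_ge[OF dec[OF that] lim[OF that]])
  have "\<exists>N. \<forall>x\<in>C. f N x < e"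
  proof (rule ccontr)
    assume "\<nexists>N. \<forall>x\<in>C. f N x < e"
    then have "\<forall>N. \<exists>x\<in>C. e \<le> f N x" by (meson not_le)
    then obtain x where x: "\<And>N. x N \<in> C" "\<And>N. e \<le> f N (x N)" by metis
    obtain z r where z: "z \<in> C" and r: "strict_mono r" and xz: "(x \<circ> r) \<longlonglongrightarrow> z"
      using compact_imp_seq_compact[OF C] x(1) by (blast elim: seq_compactE[of C x])
    have "e \<le> f m z" for m
    proof (rule LIMSEQ_le_const)
      show "(\<lambda>n. f m ((x \<circ> r) n)) \<longlonglongrightarrow> f m z"
        by (rule continuous_on_tendsto_compose[OF cont xz z]) (simp add: x)
      have "e \<le> f m (x (r n))" if "m \<le> n" for n
      proof -
        have "m \<le> r n" using that seq_suble[OF r, of n] by simp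
        then show ?thesis using decseqD[OF dec[OF x(1)], of m "r n" "r n"] x(2)[of "r n"] by simp
      qed
      then show "\<exists>N. \<forall>n\<ge>N. e \<le> f m ((x \<circ> r) n)" by auto
    qed
    then have "e \<le> 0" by (intro LIMSEQ_le_const[OF lim[OF z]]) auto
    then show False using e by simp
  qed
  then obtain N where N: "\<And>x. x \<in> C \<Longrightarrow> f N x < e" by blast
  show "\<forall>\<^sub>F n in sequentially. \<forall>x\<in>C. dist (f n x) 0 < e"
    using eventually_ge_at_top[of N]
  proof eventually_elim
    case (elim n)
    show ?case
      using N nonneg decseqD[OF dec elim] by (fastforce simp: dist_real_def)
  qed
qed

section \<open>The invariant mean as the limit of the iterates\<close>

lemma continuous_on_iterate:
  assumes "averaging I T"
  shows "continuous_on (cpow I) (T ^^ n)"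
proof (induction n)
  case 0
  show ?case by simp
next
  case (Suc n)
  have "continuous_on (cpow I) (\<lambda>x. T ((T ^^ n) x))"
    by (rule continuous_on_compose2[OF averagingD(2)[OF assms] Suc])
      (use iterate_in_cpow[OF averagingD(1)[OF assms]] in auto)
  then show ?case by (simp add: o_def)
qed

text \<open>Invariance gives \<open>K x = K (T\<^sup>n x)\<close>, and the mean property places this number between the
  extreme coordinates of \<open>T\<^sup>n x\<close>; so each coordinate is off by at most the spread. The factor is
  the price of comparing the Euclidean norm with the sum of the coordinates.\<close>

lemma dist_iterate_invariant_mean_le:
  fixes T :: "real ^ 'n \<Rightarrow> real ^ 'n"
  assumes T: "mean_type I T" and K: "is_mean I K" "invariant I T K" and x: "x \<in> cpow I"
  shows "dist ((T ^^ n) x) (\<chi> i. K x) \<le> CARD('n) * spread ((T ^^ n) x)"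
proof -
  let ?y = "(T ^^ n) x"
  have "K ?y = K x" by (rule invariant_iterate[OF T K(2) x])
  then have K_y: "coord_min ?y \<le> K x" "K x \<le> coord_max ?y"
    using is_meanD[OF K(1) iterate_in_cpow[OF T x], of n] by auto
  have "dist ?y (\<chi> i. K x) \<le> (\<Sum>i\<in>UNIV. \<bar>(?y - (\<chi> i. K x)) $ i\<bar>)"
    unfolding dist_norm by (rule norm_le_l1_cart)
  also have "\<dots> \<le> (\<Sum>i\<in>(UNIV :: 'n set). spread ?y)"
  proof (rule sum_mono)
    fix i
    show "\<bar>(?y - (\<chi> i. K x)) $ i\<bar> \<le> spread ?y"
      using K_y coord_min_le[of ?y i] le_coord_max[of ?y i] by (simp add: spread_def)
  qed
  finally show ?thesis by simp
qed

lemma averaging_iterates_converge: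
  fixes T :: "real ^ 'n \<Rightarrow> real ^ 'n"
  assumes I: "is_interval I" and T: "averaging I T" and K: "is_mean I K" "invariant I T K"
  shows "iterates_converge I T (\<lambda>x. \<chi> i. K x)"
  unfolding iterates_converge_def
proof (intro allI impI uniform_limitI)
  fix C :: "(real ^ 'n) set" and e :: real assume C: "compact C \<and> C \<subseteq> cpow I" and e: "e > 0"
  note mt = averagingD(1)[OF T]
  have "uniform_limit C (\<lambda>n x. spread ((T ^^ n) x)) (\<lambda>_. 0) sequentially"
  proof (rule decreasing_continuous_uniform_limit_0)
    show "continuous_on C (\<lambda>x. spread ((T ^^ n) x))" for n
      using C continuous_on_subset[OF continuous_on_iterate[OF T]]
      by (intro continuous_on_compose2[OF continuous_on_spread[of UNIV]]) auto
  qed (use C decseq_spread_iterates[OF mt] averaging_spread_tendsto_0[OF I T] in auto)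
  moreover have "e / CARD('n) > 0" using e by simp
  ultimately have "\<forall>\<^sub>F n in sequentially. \<forall>x\<in>C. dist (spread ((T ^^ n) x)) 0 < e / CARD('n)"
    by (rule uniform_limitD)
  then show "\<forall>\<^sub>F n in sequentially. \<forall>x\<in>C. dist ((T ^^ n) x) (\<chi> i. K x) < e"
  proof eventually_elim
    case (elim n)
    show ?case
    proof
      fix x assume x: "x \<in> C"
      have "spread ((T ^^ n) x) < e / CARD('n)"
        using elim x by (auto simp: dist_real_def)
      then have "CARD('n) * spread ((T ^^ n) x) < e"
        by (simp add: pos_less_divide_eq mult.commute)
      moreover have "dist ((T ^^ n) x) (\<chi> i. K x) \<le> CARD('n) * spread ((T ^^ n) x)"
        using C x by (intro dist_iterate_invariant_mean_le[OF mt K]) auto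
      ultimately show "dist ((T ^^ n) x) (\<chi> i. K x) < e" by linarith
    qed
  qed
qed

lemma averaging_iterates_tendsto:
  fixes T :: "real ^ 'n \<Rightarrow> real ^ 'n"
  assumes "is_interval I" "averaging I T" "is_mean I K" "invariant I T K" "x \<in> cpow I"
  shows "(\<lambda>n. (T ^^ n) x) \<longlonglongrightarrow> (\<chi> i. K x)"
proof -
  have "uniform_limit {x} (\<lambda>n. T ^^ n) (\<lambda>x. \<chi> i. K x) sequentially"
    by (rule averaging_iterates_converge[OF assms(1-4), unfolded iterates_converge_def, rule_format])
      (use assms(5) in simp)
  from tendsto_uniform_limitI[OF this singletonI] show ?thesis .
qed

lemma averaging_invariant_mean_unique:
  fixes T :: "real ^ 'n \<Rightarrow> real ^ 'n"
  assumes "is_interval I" "averaging I T" "is_mean I K" "invariant I T K"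
    "is_mean I K'" "invariant I T K'" "x \<in> cpow I"
  shows "K' x = K x"
proof -
  have "(\<chi> i. K' x) = ((\<chi> i. K x) :: real ^ 'n)"
    by (rule LIMSEQ_unique[OF averaging_iterates_tendsto[OF assms(1,2,5,6,7)]
          averaging_iterates_tendsto[OF assms(1-4,7)]])
  then show ?thesis by (simp add: vec_eq_iff)
qed

text \<open>The limit of the smallest coordinate along the orbit depends on the tail of the orbit only, so
  it is invariant.\<close>

lemma ex_invariant_mean:
  fixes T :: "real ^ 'n \<Rightarrow> real ^ 'n"
  assumes I: "is_interval I" and T: "mean_type I T"
  shows "\<exists>K. is_mean I K \<and> invariant I T K"
proof -
  define K where "K x = lim (\<lambda>n. coord_min ((T ^^ n) x))" for x
  have bounds: "coord_min ((T ^^ n) x) \<le> coord_max x" if "x \<in> cpow I" for n x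
    using decseqD[OF decseq_coord_max_iterates[OF T that], of 0 n] coord_min_le le_coord_max
    by (metis funpow_0 order_trans le0)
  have lim: "(\<lambda>n. coord_min ((T ^^ n) x)) \<longlonglongrightarrow> K x" if "x \<in> cpow I" for x
    using incseq_convergent[OF incseq_coord_min_iterates[OF T that], of "coord_max x"]
      bounds[OF that] limI unfolding K_def by blast
  have "is_mean I K"
  proof (rule is_meanI)
    fix x :: "real ^ 'n" assume x: "x \<in> cpow I"
    have "coord_min x \<le> K x"
      using incseq_le[OF incseq_coord_min_iterates[OF T x] lim[OF x], of 0] by simp
    moreover have "K x \<le> coord_max x"
      using bounds[OF x] by (intro LIMSEQ_le_const2[OF lim[OF x]]) auto
    ultimately show "K x \<in> I \<and> coord_min x \<le> K x \<and> K x \<le> coord_max x"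
      using I coord_min_in[OF x] coord_max_in[OF x] by (meson is_interval_1)
  qed
  moreover have "invariant I T K"
    unfolding invariant_def
  proof
    fix x :: "real ^ 'n" assume x: "x \<in> cpow I"
    have "(\<lambda>n. coord_min ((T ^^ n) (T x))) \<longlonglongrightarrow> K x"
      using LIMSEQ_Suc[OF lim[OF x]] by (simp add: funpow_swap1)
    then show "K (T x) = K x"
      by (rule LIMSEQ_unique[OF lim[OF mean_typeD(1)[OF T x]]])
  qed
  ultimately show ?thesis by blast
qed

section \<open>Invariant functions that are continuous on the diagonal\<close>

text \<open>The orbit of \<open>x\<close> tends to the diagonal point \<open>(K x, ..., K x)\<close>, where \<open>F\<close> is continuous, while
  \<open>F\<close> is constant along the orbit. Hence \<open>\<phi>\<close> has to be the restriction of \<open>F\<close> to the diagonal.\<close>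

lemma averaging_invariant_function_iff:
  fixes F :: "real ^ 'n \<Rightarrow> real"
  assumes I: "is_interval I" and T: "averaging I T" and K: "is_mean I K" "invariant I T K"
    and K_cont: "continuous_on (cpow I) K"
  shows "continuous_on_diagonal I F \<and> invariant I T F \<longleftrightarrow>
    (\<exists>\<phi>. continuous_on I \<phi> \<and> (\<forall>x\<in>cpow I. F x = \<phi> (K x)))"
proof
  assume F: "continuous_on_diagonal I F \<and> invariant I T F"
  have diag: "continuous (at (\<chi> i. t) within cpow I) F" if "t \<in> I" for t
    using F that by (auto simp: continuous_on_diagonal_def diagonal_def cpow_def)
  let ?\<phi> = "\<lambda>t. F (\<chi> i. t)"
  have "continuous_on I ?\<phi>"
    unfolding continuous_on_eq_continuous_within
  proof
    fix t assume t: "t \<in> I"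
    show "continuous (at t within I) ?\<phi>"
    proof (rule continuous_within_compose2[where f = "\<lambda>t. \<chi> i. t" and g = F])
      have "continuous_on I (\<lambda>t. (\<chi> i. t) :: real ^ 'n)"
        by (intro continuous_intros)
      then show "continuous (at t within I) (\<lambda>t. (\<chi> i. t) :: real ^ 'n)"
        using t by (simp add: continuous_on_eq_continuous_within)
      show "continuous (at (\<chi> i. t) within (\<lambda>t. \<chi> i. t) ` I) F"
        by (rule continuous_within_subset[OF diag[OF t]]) (auto simp: cpow_def)
    qed
  qed
  moreover have "F x = ?\<phi> (K x)" if x: "x \<in> cpow I" for x
  proof (rule LIMSEQ_unique)
    have "(\<lambda>n. F ((T ^^ n) x)) \<longlonglongrightarrow> ?\<phi> (K x)"
      by (rule continuous_within_tendsto_compose'[OF diag[OF is_meanD(1)[OF K(1) x]]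
            iterate_in_cpow[OF averagingD(1)[OF T] x] averaging_iterates_tendsto[OF I T K x]])
    then show "(\<lambda>n. F x) \<longlonglongrightarrow> ?\<phi> (K x)"
      using F x by (simp add: invariant_iterate[OF averagingD(1)[OF T]])
  qed simp
  ultimately show "\<exists>\<phi>. continuous_on I \<phi> \<and> (\<forall>x\<in>cpow I. F x = \<phi> (K x))"
    by blast
next
  assume "\<exists>\<phi>. continuous_on I \<phi> \<and> (\<forall>x\<in>cpow I. F x = \<phi> (K x))"
  then obtain \<phi> where \<phi>: "continuous_on I \<phi>" "\<And>x. x \<in> cpow I \<Longrightarrow> F x = \<phi> (K x)"
    by blast
  have "continuous_on (cpow I) (\<lambda>x. \<phi> (K x))"
    by (rule continuous_on_compose2[OF \<phi>(1) K_cont]) (use is_meanD(1)[OF K(1)] in auto)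
  then have "continuous_on (cpow I) F"
    using \<phi>(2) by (simp cong: continuous_on_cong)
  then have "continuous_on_diagonal I F"
    by (auto simp: continuous_on_diagonal_def diagonal_def continuous_on_eq_continuous_within)
  moreover have "invariant I T F"
    using \<phi>(2) mean_typeD(1)[OF averagingD(1)[OF T]] invariantD[OF K(2)]
    by (simp add: invariant_def)
  ultimately show "continuous_on_diagonal I F \<and> invariant I T F" ..
qed

section \<open>Monotone homogeneous means\<close>

text \<open>Off the diagonal, raising all coordinates to the largest one raises at least one of them strictly; on a constant
  vector a mean is that constant.\<close>

lemma monotone_mean_strictly_between:
  fixes N :: "real ^ 'n \<Rightarrow> real"
  assumes N: "monotone_mean I N" and x: "x \<in> cpow I" and ne: "spread x \<noteq> 0"
  shows "coord_min x < N x" "N x < coord_max x"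
proof -
  have mean: "is_mean I N" using N by (simp add: monotone_mean_def)
  have less: "coord_min x < coord_max x"
    using ne spread_nonneg[of x] by (simp add: spread_def)
  have c_in: "(\<chi> i. c) \<in> cpow I" if "c \<in> I" for c
    using that by (simp add: cpow_def)
  have N_const: "N (\<chi> i. c) = c" if "c \<in> I" for c
    using is_meanD[OF mean c_in[OF that]] by simp
  obtain k where "coord_max x = x $ k" using coord_max_attained by blast
  then have "N (\<chi> i. coord_min x) < N x"
    using less coord_min_le[of x]
    by (intro monotone_mean_less[OF N c_in[OF coord_min_in[OF x]] x, where k = k]) auto
  then show "coord_min x < N x" using N_const[OF coord_min_in[OF x]] by simp
  obtain k where "coord_min x = x $ k" using coord_min_attained by blast
  then have "N x < N (\<chi> i. coord_max x)"
    using less le_coord_max[of x]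
    by (intro monotone_mean_less[OF N x c_in[OF coord_max_in[OF x]], where k = k]) auto
  then show "N x < coord_max x" using N_const[OF coord_max_in[OF x]] by simp
qed

lemma homogeneousD:
  "homogeneous N \<Longrightarrow> t > 0 \<Longrightarrow> x \<in> cpow {0<..} \<Longrightarrow> N (t *\<^sub>R x) = t * N x"
  by (simp add: homogeneous_def)

lemma scaleR_in_cpow_pos: "t > 0 \<Longrightarrow> x \<in> cpow {0<..} \<Longrightarrow> t *\<^sub>R x \<in> cpow {0<..}"
  by (simp add: cpow_def)

text \<open>With \<open>a\<close> and \<open>b\<close> the smallest and largest of the quotients \<open>y $ i / x $ i\<close>, the vector \<open>y\<close> lies
  between \<open>a x\<close> and \<open>b x\<close>, so \<open>N y\<close> lies between \<open>a N x\<close> and \<open>b N x\<close>; both factors tend to \<open>1\<close> as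
  \<open>y\<close> tends to \<open>x\<close>.\<close>

lemma continuous_on_monotone_homogeneous_mean:
  fixes N :: "real ^ 'n \<Rightarrow> real"
  assumes N: "monotone_mean {0<..} N" and hom: "homogeneous N"
  shows "continuous_on (cpow {0<..}) N"
  unfolding continuous_on_def
proof
  fix x :: "real ^ 'n" assume x: "x \<in> cpow {0<..}"
  then have x_pos: "x $ i > 0" for i by (simp add: cpow_def)
  define q where "q y = (\<chi> i. y $ i / x $ i)" for y
  have q_x: "q x = (\<chi> i. 1)" using x_pos by (simp add: q_def vec_eq_iff less_imp_neq[symmetric])
  have q_lim: "(q \<longlongrightarrow> q x) (at x within cpow {0<..})"
    unfolding q_def by (intro tendsto_intros) (use x_pos in \<open>auto simp: less_imp_neq[symmetric]\<close>)
  have q_in: "q y \<in> cpow {0<..}" if "y \<in> cpow {0<..}" for y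
    using that x_pos by (simp add: q_def cpow_def)
  have lower: "coord_min (q y) * N x \<le> N y" and upper: "N y \<le> coord_max (q y) * N x"
    if y: "y \<in> cpow {0<..}" for y
  proof -
    have pos: "coord_min (q y) > 0" "coord_max (q y) > 0"
      using coord_min_in[OF q_in[OF y]] coord_max_in[OF q_in[OF y]] by auto
    have "coord_min (q y) * x $ i \<le> y $ i" "y $ i \<le> coord_max (q y) * x $ i" for i
      using coord_min_le[of "q y" i] le_coord_max[of "q y" i] x_pos[of i]
      by (simp_all add: q_def field_simps)
    then have "N (coord_min (q y) *\<^sub>R x) \<le> N y" "N y \<le> N (coord_max (q y) *\<^sub>R x)"
      using pos x y by (auto intro!: monotone_mean_le[OF N] scaleR_in_cpow_pos)
    then show "coord_min (q y) * N x \<le> N y" "N y \<le> coord_max (q y) * N x"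
      using homogeneousD[OF hom _ x] pos by auto
  qed
  have in_cpow: "\<forall>\<^sub>F y in at x within cpow {0<..}. y \<in> cpow {0<..}"
    by (simp add: eventually_at_filter)
  show "(N \<longlongrightarrow> N x) (at x within cpow {0<..})"
  proof (rule tendsto_sandwich)
    show "\<forall>\<^sub>F y in at x within cpow {0<..}. coord_min (q y) * N x \<le> N y"
      using in_cpow by (rule eventually_mono) (rule lower)
    show "\<forall>\<^sub>F y in at x within cpow {0<..}. N y \<le> coord_max (q y) * N x"
      using in_cpow by (rule eventually_mono) (rule upper)
    show "((\<lambda>y. coord_min (q y) * N x) \<longlongrightarrow> N x) (at x within cpow {0<..})"
      using tendsto_mult_right[OF tendsto_coord_min[OF q_lim], of "N x"] by (simp add: q_x)
    show "((\<lambda>y. coord_max (q y) * N x) \<longlongrightarrow> N x) (at x within cpow {0<..})"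
      using tendsto_mult_right[OF tendsto_coord_max[OF q_lim], of "N x"] by (simp add: q_x)
  qed
qed

lemma averaging_monotone_homogeneous:
  assumes T: "mean_type {0<..} T"
    and mono: "\<And>i. monotone_mean {0<..} (\<lambda>x. T x $ i)"
    and hom: "\<And>i. homogeneous (\<lambda>x. T x $ i)"
  shows "averaging {0<..} T"
proof -
  have "continuous_on (cpow {0<..}) (\<lambda>x. \<chi> i. T x $ i)"
    by (intro continuous_on_vec_lambda continuous_on_monotone_homogeneous_mean mono hom)
  then show ?thesis
    using T monotone_mean_strictly_between[OF mono] by (simp add: averaging_def)
qed

lemma monotone_iterates:
  assumes T: "mean_type I T" and mono: "\<And>i. monotone_mean I (\<lambda>x. T x $ i)"
    and x: "x \<in> cpow I" and y: "y \<in> cpow I" and le: "\<And>i. x $ i \<le> y $ i"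
  shows "(T ^^ n) x $ i \<le> (T ^^ n) y $ i"
proof (induction n arbitrary: i)
  case 0
  show ?case by (simp add: le)
next
  case (Suc n)
  then show ?case
    using monotone_mean_le[OF mono iterate_in_cpow[OF T x] iterate_in_cpow[OF T y]] by simp
qed

lemma homogeneous_iterates:
  assumes T: "mean_type {0<..} T" and hom: "\<And>i. homogeneous (\<lambda>x. T x $ i)"
    and t: "t > 0" and x: "x \<in> cpow {0<..}"
  shows "(T ^^ n) (t *\<^sub>R x) = t *\<^sub>R (T ^^ n) x"
proof (induction n)
  case 0
  show ?case by simp
next
  case (Suc n)
  have "T (t *\<^sub>R (T ^^ n) x) = t *\<^sub>R T ((T ^^ n) x)"
    using homogeneousD[OF hom t iterate_in_cpow[OF T x]] by (simp add: vec_eq_iff)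
  then show ?case by (simp add: Suc)
qed

text \<open>Homogeneity and weak monotonicity pass to the limit of the iterates. Strictness is lost in the
  limit but recovered by one application of \<open>T\<close>: it makes all coordinates of \<open>T y\<close> exceed those of
  \<open>T x\<close>, so \<open>T y \<ge> c T x\<close> for some \<open>c > 1\<close>, and homogeneity yields \<open>K y \<ge> c K x\<close>.\<close>

lemma invariant_mean_monotone_homogeneous:
  fixes T :: "real ^ 'n \<Rightarrow> real ^ 'n"
  assumes T: "mean_type {0<..} T"
    and mono: "\<And>i. monotone_mean {0<..} (\<lambda>x. T x $ i)"
    and hom: "\<And>i. homogeneous (\<lambda>x. T x $ i)"
    and K: "is_mean {0<..} K" "invariant {0<..} T K"
  shows "monotone_mean {0<..} K" "homogeneous K"
proof -
  have av: "averaging {0<..} T" by (rule averaging_monotone_homogeneous[OF T mono hom])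
  have lim: "(\<lambda>n. (T ^^ n) x $ i) \<longlonglongrightarrow> K x" if "x \<in> cpow {0<..}" for x i
    using tendsto_vec_nth[OF averaging_iterates_tendsto[OF is_interval_oi av K that], of i] by simp
  show hom_K: "homogeneous K"
    unfolding homogeneous_def
  proof (intro allI impI ballI)
    fix t :: real and x :: "real ^ 'n" assume t: "t > 0" and x: "x \<in> cpow {0<..}"
    have "(\<lambda>n. t * (T ^^ n) x $ i) \<longlonglongrightarrow> K (t *\<^sub>R x)" for i
      using lim[OF scaleR_in_cpow_pos[OF t x], of i]
      by (simp add: homogeneous_iterates[OF T hom t x])
    then show "K (t *\<^sub>R x) = t * K x"
      by (rule LIMSEQ_unique[OF _ tendsto_mult_left[OF lim[OF x]]])
  qed
  have K_le: "K x \<le> K y"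
    if "x \<in> cpow {0<..}" "y \<in> cpow {0<..}" "\<And>i. x $ i \<le> y $ i" for x y
    using monotone_iterates[OF T mono that]
    by (intro LIMSEQ_le[OF lim[OF that(1)] lim[OF that(2)]]) auto
  have K_less: "K x < K y"
    if x: "x \<in> cpow {0<..}" and y: "y \<in> cpow {0<..}"
      and le: "\<And>i. x $ i \<le> y $ i" and k: "x $ k < y $ k" for x y k
  proof -
    have Tx: "T x \<in> cpow {0<..}" and Ty: "T y \<in> cpow {0<..}"
      using mean_typeD(1)[OF T] x y by auto
    have less: "T x $ i < T y $ i" for i
      by (rule monotone_mean_less[OF mono x y le k])
    have pos: "T x $ i > 0" for i using Tx by (simp add: cpow_def)
    define c where "c = coord_min (\<chi> i. T y $ i / T x $ i)"
    obtain j where "c = T y $ j / T x $ j"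
      unfolding c_def using coord_min_attained[of "\<chi> i. T y $ i / T x $ i"] by auto
    then have c: "c > 1" using less[of j] pos[of j] by (simp add: less_divide_eq_1_pos)
    have "(c *\<^sub>R T x) $ i \<le> T y $ i" for i
      using coord_min_le[of "\<chi> i. T y $ i / T x $ i" i] pos[of i]
      by (simp add: c_def field_simps)
    then have "K (c *\<^sub>R T x) \<le> K (T y)"
      using c by (intro K_le scaleR_in_cpow_pos Tx Ty) auto
    then have "c * K x \<le> K y"
      using c x y homogeneousD[OF hom_K _ Tx, of c] invariantD[OF K(2)] by simp
    moreover have "K x > 0" using is_meanD(1)[OF K(1) x] by simp
    then have "1 * K x < c * K x" using c by (intro mult_strict_right_mono)
    ultimately show ?thesis by simp
  qed
  show "monotone_mean {0<..} K"
    unfolding monotone_mean_def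
  proof (intro conjI ballI allI strict_mono_onI)
    fix x :: "real ^ 'n" and i and r s :: real
    assume "x \<in> cpow {0<..}" "r \<in> {0<..}" "s \<in> {0<..}" "r < s"
    then show "K (\<chi> j. if j = i then r else x $ j) < K (\<chi> j. if j = i then s else x $ j)"
      by (intro K_less[where k = i]) (auto simp: cpow_def)
  qed (rule K(1))
qed

section \<open>Complementary means\<close>

lemma subst_coords_in_cpow:
  assumes "mean_type I T" "x \<in> cpow I" "t \<in> I"
  shows "subst_coords S (\<lambda>_. t) T x \<in> cpow I"
  using mean_typeD(1)[OF assms(1,2)] assms(3) by (simp add: subst_coords_def cpow_def)

lemma subst_coords_strict_mono:
  assumes T: "mean_type I T" and K: "monotone_mean I K" and S: "S \<noteq> {}"
    and x: "x \<in> cpow I" and s: "s \<in> I" and t: "t \<in> I"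
  shows "K (subst_coords S (\<lambda>_. s) T x) < K (subst_coords S (\<lambda>_. t) T x) \<longleftrightarrow> s < t"
proof -
  have less: "K (subst_coords S (\<lambda>_. s) T x) < K (subst_coords S (\<lambda>_. t) T x)"
    if "s < t" "s \<in> I" "t \<in> I" for s t
  proof -
    obtain k where "k \<in> S" using S by blast
    then show ?thesis
      using that
      by (intro monotone_mean_less[OF K subst_coords_in_cpow[OF T x]
            subst_coords_in_cpow[OF T x], where k = k]) (auto simp: subst_coords_def)
  qed
  show ?thesis
    using less[OF _ s t] less[OF _ t s] by (metis linorder_less_linear order_less_asym)
qed

text \<open>For fixed \<open>a\<close> in \<open>I\<close>, the inequality \<open>a < N y\<close> is equivalent to a strict inequality between two
  functions of \<open>y\<close> that are continuous, because \<open>K\<close> increases strictly in the substituted value. So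
  the sets \<open>{y. a < N y}\<close> and \<open>{y. N y < a}\<close> are relatively open.\<close>

lemma continuous_on_complementary_mean:
  fixes T :: "real ^ 'n \<Rightarrow> real ^ 'n"
  assumes I: "is_interval I" and T: "mean_type I T" "continuous_on (cpow I) T"
    and K: "monotone_mean I K" "continuous_on (cpow I) K" and S: "S \<noteq> {}"
    and N: "N \<in> cpow I \<rightarrow> I" "\<And>x. x \<in> cpow I \<Longrightarrow> K (subst_coords S (\<lambda>_. N x) T x) = K x"
  shows "continuous_on (cpow I) N"
  unfolding continuous_on_def
proof
  fix x :: "real ^ 'n" assume x: "x \<in> cpow I"
  let ?G = "\<lambda>a y. K (subst_coords S (\<lambda>_. a) T y)"
  let ?F = "at x within cpow I"
  have N_in: "N y \<in> I" if "y \<in> cpow I" for y using N(1) that by blast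
  have G_lim: "(?G a \<longlongrightarrow> ?G a x) ?F" if "a \<in> I" for a
  proof -
    have "continuous_on (cpow I) (\<lambda>y. if i \<in> S then a else T y $ i)" for i
      using T(2) by (cases "i \<in> S") (auto intro: continuous_intros)
    then have "continuous_on (cpow I) (\<lambda>y. subst_coords S (\<lambda>_. a) T y)"
      unfolding subst_coords_def by (intro continuous_on_vec_lambda)
    then have "continuous_on (cpow I) (?G a)"
      by (rule continuous_on_compose2[OF K(2)]) (use subst_coords_in_cpow[OF T(1) _ that] in auto)
    then show ?thesis using x by (simp add: continuous_on_def)
  qed
  have K_lim: "(K \<longlongrightarrow> K x) ?F" using K(2) x by (simp add: continuous_on_def)
  have in_cpow: "\<forall>\<^sub>F y in ?F. y \<in> cpow I" by (simp add: eventually_at_filter)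
  have sign: "?G a y < K y \<longleftrightarrow> a < N y" "K y < ?G a y \<longleftrightarrow> N y < a"
    if "y \<in> cpow I" "a \<in> I" for a y
    using subst_coords_strict_mono[OF T(1) K(1) S that(1) that(2) N_in[OF that(1)]]
      subst_coords_strict_mono[OF T(1) K(1) S that(1) N_in[OF that(1)] that(2)] N(2)[OF that(1)]
    by simp_all
  show "(N \<longlongrightarrow> N x) ?F"
  proof (rule order_tendstoI)
    fix a assume a: "a < N x"
    show "\<forall>\<^sub>F y in ?F. a < N y"
    \<comment> \<open>\<open>K\<close> says nothing about values outside \<open>I\<close>. Such an \<open>a\<close> lies on the same side of the whole
      interval, so it is on the same side of all values of \<open>N\<close>.\<close>
    proof (cases "a \<in> I")
      case True
      then have "((\<lambda>y. K y - ?G a y) \<longlongrightarrow> K x - ?G a x) ?F" "0 < K x - ?G a x"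
        using a sign[OF x] by (auto intro: tendsto_diff K_lim G_lim)
      then have "\<forall>\<^sub>F y in ?F. 0 < K y - ?G a y" by (rule order_tendstoD(1))
      with in_cpow show ?thesis by eventually_elim (simp add: sign True)
    next
      case False
      then have "a < N y" if "y \<in> cpow I" for y
        using I N_in[OF that] N_in[OF x] a by (meson is_interval_1 less_imp_le not_le)
      with in_cpow show ?thesis by (simp add: eventually_mono)
    qed
  next
    fix a assume a: "N x < a"
    show "\<forall>\<^sub>F y in ?F. N y < a"
    proof (cases "a \<in> I")
      case True
      then have "((\<lambda>y. ?G a y - K y) \<longlongrightarrow> ?G a x - K x) ?F" "0 < ?G a x - K x"
        using a sign[OF x] by (auto intro: tendsto_diff K_lim G_lim)
      then have "\<forall>\<^sub>F y in ?F. 0 < ?G a y - K y" by (rule order_tendstoD(1))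
      with in_cpow show ?thesis by eventually_elim (simp add: sign True)
    next
      case False
      then have "N y < a" if "y \<in> cpow I" for y
        using I N_in[OF that] N_in[OF x] a by (meson is_interval_1 less_imp_le not_le)
      with in_cpow show ?thesis by (simp add: eventually_mono)
    qed
  qed
qed

text \<open>The coordinates outside \<open>S\<close> are those of \<open>T\<close>. The new mean \<open>N\<close> cannot attain an extreme value:
  off the diagonal, putting the largest coordinate of \<open>x\<close> in place of the smaller values of \<open>T x\<close>
  would make \<open>K\<close> larger than \<open>K (T x) = K x\<close>, while putting \<open>N x\<close> there keeps \<open>K\<close> equal to it.
  The smallest coordinate is excluded in the same way.\<close>

lemma compl_map_averaging:
  fixes T :: "real ^ 'n \<Rightarrow> real ^ 'n"
  assumes I: "is_interval I" and T: "averaging I T"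
    and K: "monotone_mean I K" "continuous_on (cpow I) K" "invariant I T K" and S: "S \<noteq> {}"
  shows "averaging I (compl_map I K T S)" "invariant I (compl_map I K T S) K"
proof -
  note mt = averagingD(1)[OF T]
  define N where "N = compl_mean I K T S"
  have map_N: "compl_map I K T S = subst_coords S N T"
    by (simp add: compl_map_def N_def)
  have subst_N: "subst_coords S N T x = subst_coords S (\<lambda>_. N x) T x" for x
    by (simp add: subst_coords_def)
  have N: "is_mean I N" "invariant I (subst_coords S N T) K"
    using theI'[OF ex1_compl_mean[OF I K(2,1) mt K(3) S]]
    by (simp_all add: N_def compl_mean_def)
  have N_eq: "K (subst_coords S (\<lambda>_. N x) T x) = K x" if "x \<in> cpow I" for x
    using invariantD[OF N(2) that] by (simp add: subst_N)
  show "invariant I (compl_map I K T S) K" using N(2) by (simp add: map_N)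
  have comp: "compl_map I K T S x $ i = (if i \<in> S then N x else T x $ i)" for x i
    by (simp add: map_N subst_coords_def)
  have N_cont: "continuous_on (cpow I) N"
    by (rule continuous_on_complementary_mean[OF I mt averagingD(2)[OF T] K(1,2) S])
      (use N_eq is_meanD(1)[OF N(1)] in auto)
  have "mean_type I (compl_map I K T S)"
    unfolding mean_type_def comp
  proof
    fix i
    show "is_mean I (\<lambda>x. if i \<in> S then N x else T x $ i)"
      using N(1) mt by (cases "i \<in> S") (simp_all add: mean_type_def)
  qed
  moreover have "continuous_on (cpow I) (compl_map I K T S)"
  proof -
    have "continuous_on (cpow I) (\<lambda>x. if i \<in> S then N x else T x $ i)" for i
      using N_cont averagingD(2)[OF T] by (cases "i \<in> S") (auto intro: continuous_intros)
    then show ?thesis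
      unfolding map_N subst_coords_def by (intro continuous_on_vec_lambda)
  qed
  moreover have "coord_min x < N x \<and> N x < coord_max x"
    if x: "x \<in> cpow I" and ne: "spread x \<noteq> 0" for x
  proof -
    obtain k where k: "k \<in> S" using S by blast
    note Tx = mean_typeD(1)[OF mt x]
    have KT: "K (T x) = K x" by (rule invariantD[OF K(3) x])
    note bounds = averagingD(3,4)[OF T x ne]
    have "K (T x) < K (subst_coords S (\<lambda>_. coord_max x) T x)"
      using k bounds coord_max_in[OF x]
      by (intro monotone_mean_less[OF K(1) Tx subst_coords_in_cpow[OF mt x], where k = k])
        (auto simp: subst_coords_def less_imp_le)
    then have "N x \<noteq> coord_max x" using KT N_eq[OF x] by auto
    moreover have "K (subst_coords S (\<lambda>_. coord_min x) T x) < K (T x)"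
      using k bounds coord_min_in[OF x]
      by (intro monotone_mean_less[OF K(1) subst_coords_in_cpow[OF mt x] Tx, where k = k])
        (auto simp: subst_coords_def less_imp_le)
    then have "N x \<noteq> coord_min x" using KT N_eq[OF x] by auto
    ultimately show ?thesis using is_meanD(2,3)[OF N(1) x] by simp
  qed
  ultimately show "averaging I (compl_map I K T S)"
    using averagingD(3,4)[OF T] by (simp add: averaging_def comp)
qed

theorem theorem3:
  fixes M :: "real ^ 'n \<Rightarrow> real ^ 'n"
  assumes "CARD('n) > 1"
    and "mean_type {0<..} M"
    and "\<And>i. monotone_mean {0<..} (\<lambda>x. M x $ i)"
    and "\<And>i. homogeneous (\<lambda>x. M x $ i)"
  shows "\<exists>K :: real ^ 'n \<Rightarrow> real.
    (is_mean {0<..} K \<and> invariant {0<..} M K \<and>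
     (\<forall>K'. is_mean {0<..} K' \<and> invariant {0<..} M K' \<longrightarrow> (\<forall>x\<in>cpow {0<..}. K' x = K x)) \<and>
     iterates_converge {0<..} M (\<lambda>x. \<chi> i. K x)) \<and>
    (monotone_mean {0<..} K \<and> homogeneous K \<and>
     (\<forall>S. S \<noteq> {} \<longrightarrow> iterates_converge {0<..} (compl_map {0<..} K M S) (\<lambda>x. \<chi> i. K x))) \<and>
    (\<forall>F. continuous_on_diagonal {0<..} F \<and> invariant {0<..} M F \<longleftrightarrow>
       (\<exists>\<phi> :: real \<Rightarrow> real. continuous_on {0<..} \<phi> \<and> (\<forall>x\<in>cpow {0<..}. F x = \<phi> (K x)))) \<and>
    (\<forall>F. continuous_on_diagonal {0<..} F \<and>
         (\<forall>S. S \<noteq> {} \<longrightarrow> invariant {0<..} (compl_map {0<..} K M S) F) \<longleftrightarrow>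
       (\<exists>\<phi> :: real \<Rightarrow> real. continuous_on {0<..} \<phi> \<and> (\<forall>x\<in>cpow {0<..}. F x = \<phi> (K x)))) \<and>
    (\<forall>F. continuous_on_diagonal {0<..} F \<longrightarrow>
       (invariant {0<..} M F \<longleftrightarrow>
        (\<forall>S. S \<noteq> {} \<longrightarrow> invariant {0<..} (compl_map {0<..} K M S) F)))"
proof -
  have I: "is_interval ({0<..} :: real set)" by (rule is_interval_oi)
  have M: "averaging {0<..} M"
    by (rule averaging_monotone_homogeneous[OF assms(2,3,4)])
  obtain K where K: "is_mean {0<..} K" "invariant {0<..} M K"
    using ex_invariant_mean[OF I assms(2)] by blast
  have mono: "monotone_mean {0<..} K" and hom: "homogeneous K"
    by (rule invariant_mean_monotone_homogeneous[OF assms(2,3,4) K])+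
  have cont: "continuous_on (cpow {0<..}) K"
    by (rule continuous_on_monotone_homogeneous_mean[OF mono hom])
  have compl: "averaging {0<..} (compl_map {0<..} K M S)"
    "invariant {0<..} (compl_map {0<..} K M S) K" if "S \<noteq> {}" for S
    using compl_map_averaging[OF I M mono cont K(2) that] by auto
  have M_iff: "continuous_on_diagonal {0<..} F \<and> invariant {0<..} M F \<longleftrightarrow>
      (\<exists>\<phi>. continuous_on {0<..} \<phi> \<and> (\<forall>x\<in>cpow {0<..}. F x = \<phi> (K x)))" for F
    by (rule averaging_invariant_function_iff[OF I M K cont])
  have compl_iff: "continuous_on_diagonal {0<..} F \<and> invariant {0<..} (compl_map {0<..} K M S) F \<longleftrightarrow>
      (\<exists>\<phi>. continuous_on {0<..} \<phi> \<and> (\<forall>x\<in>cpow {0<..}. F x = \<phi> (K x)))" if "S \<noteq> {}" for F S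
    by (rule averaging_invariant_function_iff[OF I compl(1)[OF that] K(1) compl(2)[OF that] cont])
  have system_iff: "continuous_on_diagonal {0<..} F \<and>
      (\<forall>S. S \<noteq> {} \<longrightarrow> invariant {0<..} (compl_map {0<..} K M S) F) \<longleftrightarrow>
      (\<exists>\<phi>. continuous_on {0<..} \<phi> \<and> (\<forall>x\<in>cpow {0<..}. F x = \<phi> (K x)))" for F
    \<comment> \<open>The equation for \<open>S = UNIV\<close> already yields \<open>\<phi>\<close>.\<close>
    using compl_iff[of _ F] compl_iff[of UNIV F] by blast
  show ?thesis
  proof (intro exI[of _ K] conjI)
    show "is_mean {0<..} K" "invariant {0<..} M K" "monotone_mean {0<..} K" "homogeneous K"
      by (rule K mono hom)+
    show "\<forall>K'. is_mean {0<..} K' \<and> invariant {0<..} M K' \<longrightarrow> (\<forall>x\<in>cpow {0<..}. K' x = K x)"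
      using averaging_invariant_mean_unique[OF I M K] by blast
    show "iterates_converge {0<..} M (\<lambda>x. \<chi> i. K x)"
      by (rule averaging_iterates_converge[OF I M K])
    show "\<forall>S. S \<noteq> {} \<longrightarrow> iterates_converge {0<..} (compl_map {0<..} K M S) (\<lambda>x. \<chi> i. K x)"
      using averaging_iterates_converge[OF I compl(1) K(1) compl(2)] by blast
    show "\<forall>F. continuous_on_diagonal {0<..} F \<longrightarrow> (invariant {0<..} M F \<longleftrightarrow>
        (\<forall>S. S \<noteq> {} \<longrightarrow> invariant {0<..} (compl_map {0<..} K M S) F))"
    proof (intro allI impI)
      fix F :: "real ^ 'n \<Rightarrow> real" assume "continuous_on_diagonal {0<..} F"
      then show "invariant {0<..} M F \<longleftrightarrow>
          (\<forall>S. S \<noteq> {} \<longrightarrow> invariant {0<..} (compl_map {0<..} K M S) F)"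
        using M_iff[of F] system_iff[of F] by argo
    qed
    show "\<forall>F. continuous_on_diagonal {0<..} F \<and> invariant {0<..} M F \<longleftrightarrow>
        (\<exists>\<phi>. continuous_on {0<..} \<phi> \<and> (\<forall>x\<in>cpow {0<..}. F x = \<phi> (K x)))"
      by (rule allI) (rule M_iff)
    show "\<forall>F. continuous_on_diagonal {0<..} F \<and>
        (\<forall>S. S \<noteq> {} \<longrightarrow> invariant {0<..} (compl_map {0<..} K M S) F) \<longleftrightarrow>
        (\<exists>\<phi>. continuous_on {0<..} \<phi> \<and> (\<forall>x\<in>cpow {0<..}. F x = \<phi> (K x)))"
      by (rule allI) (rule system_iff)
  qed
qed

end
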